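(* Let $n_p,n,N$ be positive integers; consider images with $n$ pixels from which $N$ patches of $n_p$ pixels are extracted with unit stride and periodic boundary conditions, $\mathbf{P}_i\in\{0,1\}^{n_p\times n}$ being the binary matrix extracting patch $i$. Let $\mathbf{C}_1,\dots,\mathbf{C}_K\in\mathbb{R}^{n_p\times n_p}$ be symmetric positive semi-definite, $\sigma^2>0$, and $\beta_j^i\ge0$ with $\sum_{j=1}^K\beta_j^i=1$ for each $i$. Define $\mathbf{F}_i=\sum_{j=1}^K\beta_j^i\mathbf{C}_j(\mathbf{C}_j+\sigma^2\mathbf{I})^{-1}$ and $\mathbf{W}=\frac1{n_p}\sum_{i=1}^N\mathbf{P}_i^T\mathbf{F}_i\mathbf{P}_i$. Let $\mathbf{W}=\mathbf{Q}\Lambda\mathbf{Q}^T$ be an eigendecomposition with eigenvalues in decreasing order, $r=\mathrm{rank}(\mathbf{W})$, $\bar\Lambda$ the $r\times r$ diagonal matrix of nonzero eigenvalues and $\bar{\mathbf{Q}}$ the first $r$ columns of $\mathbf{Q}$. Then the denoiser $\mathbf{y}\mapsto\mathbf{W}\mathbf{y}$ is the proximity operator of the closed, proper, convex function $$\phi(\mathbf{x})=\iota_{S(\mathbf{W})}(\mathbf{x})+\tfrac12\,\mathbf{x}^T\bar{\mathbf{Q}}(\bar\Lambda^{-1}-\mathbf{I})\bar{\mathbf{Q}}^T\mathbf{x}.$$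
   Context: $\mathrm{prox}_\phi(\mathbf{z})=\arg\min_{\mathbf{x}}\tfrac12\|\mathbf{x}-\mathbf{z}\|_2^2+\phi(\mathbf{x})$. $S(\mathbf{W})$ is the column span of $\mathbf{W}$ and $\iota_C$ is the indicator function of a convex set $C$ ($0$ on $C$, $+\infty$ outside). *)

theory Defs
  imports "HOL-Analysis.Analysis"
begin

text \<open>Binary patch-extraction matrix: row k of patch i selects pixel idx i k.\<close>
definition patch_mat :: "('i \<Rightarrow> 'p \<Rightarrow> 'n) \<Rightarrow> 'i \<Rightarrow> real^'n^'p::finite" where
  "patch_mat idx i = (\<chi> k p. if idx i k = p then 1 else 0)"

text \<open>Indicator function of a set, as an extended-real valued function.\<close>
definition indicator_fun :: "'a set \<Rightarrow> 'a \<Rightarrow> ereal" where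
  "indicator_fun C x = (if x \<in> C then 0 else \<infinity>)"

text \<open>Epigraph of an extended-real valued function.\<close>
definition epigraph_ext :: "('a \<Rightarrow> ereal) \<Rightarrow> ('a \<times> real) set" where
  "epigraph_ext f = {(x, t). f x \<le> ereal t}"

definition proper_fun :: "('a \<Rightarrow> ereal) \<Rightarrow> bool" where
  "proper_fun f \<longleftrightarrow> (\<forall>x. f x \<noteq> -\<infinity>) \<and> (\<exists>x. f x \<noteq> \<infinity>)"

definition convex_fun :: "('a::real_vector \<Rightarrow> ereal) \<Rightarrow> bool" where
  "convex_fun f \<longleftrightarrow> convex (epigraph_ext f)"

definition closed_fun :: "('a::topological_space \<Rightarrow> ereal) \<Rightarrow> bool" where
  "closed_fun f \<longleftrightarrow> closed (epigraph_ext f)"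

text \<open>The set of minimizers of 1/2 ||x - z||^2 + phi x; the proximity operator
  prox_phi(z) is well defined and equal to p iff this set is exactly {p}.\<close>
definition prox_set :: "('a::real_normed_vector \<Rightarrow> ereal) \<Rightarrow> 'a \<Rightarrow> 'a set" where
  "prox_set \<phi> z = {p. \<forall>x. ereal (norm (p - z)^2 / 2) + \<phi> p \<le> ereal (norm (x - z)^2 / 2) + \<phi> x}"

end

theory Submission
  imports Defs
begin

text \<open>
  Each filter C (C + sigma^2 I)^-1 has quadratic form between 0 and that of the identity;
  this survives convex combinations and the average over the patches of a periodic
  extraction, since every pixel lies in exactly n_p patches. Hence the eigenvalues of W
  lie in [0, 1], so the weights 1/lambda_k - 1 are nonnegative and phi is closed, proper
  and convex. In the eigenbasis, for x in the range of W, completing the square in each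
  coordinate gives
    |x - y|^2 + 2 phi(x) = sum_{k<r} (q_k . (x - W y))^2 / lambda_k + const(y),
  which is minimal exactly at x = W y.
\<close>

section \<open>Matrices with quadratic form between 0 and the identity\<close>

lemma matrix_vector_mult_sum_left:
  "(\<Sum>i\<in>I. (M i :: real^'n^'m)) *v x = (\<Sum>i\<in>I. M i *v x)"
  by (induction I rule: infinite_finite_induct) (auto simp: matrix_vector_mult_add_rdistrib)

lemma mat_matrix_vector_mult: "mat s *v (v :: real^'n) = s *\<^sub>R v"
proof -
  have "mat s = s *\<^sub>R (mat 1 :: real^'n^'n)" by (simp add: vec_eq_iff mat_def)
  then show ?thesis by (simp flip: scaleR_matrix_vector_assoc)
qed

lemma matrix_inv_right:
  fixes A :: "real^'n^'n"
  assumes "invertible A"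
  shows "A ** matrix_inv A = mat 1"
  using assms unfolding invertible_def matrix_inv_def by (rule someI2_ex) auto

lemma invertible_psd_plus_mat:
  fixes C :: "real^'n^'n"
  assumes psd: "\<And>v. 0 \<le> v \<bullet> (C *v v)" and s: "0 < s"
  shows "invertible (C + mat s)"
proof -
  have "v = 0" if "(C + mat s) *v v = 0" for v
  proof -
    have "v \<bullet> (C *v v) + s * (v \<bullet> v) = 0"
      using arg_cong[OF that, of "inner v"]
      by (simp add: matrix_vector_mult_add_rdistrib mat_matrix_vector_mult inner_add_right)
    then have "s * (v \<bullet> v) \<le> 0" using psd[of v] by linarith
    then have "v \<bullet> v \<le> 0" using s by (simp add: mult_le_0_iff)
    then show "v = 0" by (metis inner_eq_zero_iff inner_ge_zero order_antisym)
  qed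
  then show ?thesis
    using matrix_left_invertible_ker invertible_left_inverse by blast
qed

definition form_between_0_and_id :: "real^'n^'n \<Rightarrow> bool" where
  "form_between_0_and_id A \<longleftrightarrow> (\<forall>x. 0 \<le> x \<bullet> (A *v x) \<and> x \<bullet> (A *v x) \<le> x \<bullet> x)"

lemma form_between_0_and_id_resolvent:
  fixes C :: "real^'n^'n"
  assumes psd: "\<And>v. 0 \<le> v \<bullet> (C *v v)" and s: "0 < s"
  shows "form_between_0_and_id (C ** matrix_inv (C + mat s))" (is "form_between_0_and_id ?G")
  unfolding form_between_0_and_id_def
proof
  fix x
  define y where "y = matrix_inv (C + mat s) *v x"
  have x: "x = C *v y + s *\<^sub>R y"
    using matrix_inv_right[OF invertible_psd_plus_mat[OF psd s]]
    by (metis matrix_vector_mul_assoc matrix_vector_mul_lid matrix_vector_mult_add_rdistrib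
        mat_matrix_vector_mult y_def)
  have Gx: "?G *v x = C *v y"
    by (simp add: y_def matrix_vector_mul_assoc)
  \<comment> \<open>Both bounds are sums of nonnegative terms once x is written as C y + s y.\<close>
  have "x \<bullet> (C *v y) = (C *v y) \<bullet> (C *v y) + s * (y \<bullet> (C *v y))"
    by (subst x) (simp add: inner_add_left inner_commute[of "C *v y" y])
  moreover have "x \<bullet> x = (C *v y) \<bullet> (C *v y) + 2 * s * (y \<bullet> (C *v y)) + s * s * (y \<bullet> y)"
    by (subst (1 2) x) (simp add: inner_add_left inner_add_right inner_commute algebra_simps)
  ultimately show "0 \<le> x \<bullet> (?G *v x) \<and> x \<bullet> (?G *v x) \<le> x \<bullet> x"
    unfolding Gx using psd[of y] s by simp
qed

lemma form_between_0_and_id_convex_combination: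
  fixes G :: "'k \<Rightarrow> real^'n^'n"
  assumes "finite K" "\<And>j. j \<in> K \<Longrightarrow> 0 \<le> \<beta> j" "(\<Sum>j\<in>K. \<beta> j) = 1"
    and "\<And>j. j \<in> K \<Longrightarrow> form_between_0_and_id (G j)"
  shows "form_between_0_and_id (\<Sum>j\<in>K. \<beta> j *\<^sub>R G j)" (is "form_between_0_and_id ?A")
  unfolding form_between_0_and_id_def
proof
  fix x
  have G: "0 \<le> x \<bullet> (G j *v x)" "x \<bullet> (G j *v x) \<le> x \<bullet> x" if "j \<in> K" for j
    using assms(4)[OF that] unfolding form_between_0_and_id_def by auto
  have form: "x \<bullet> (?A *v x) = (\<Sum>j\<in>K. \<beta> j * (x \<bullet> (G j *v x)))"
    by (simp add: matrix_vector_mult_sum_left inner_sum_right flip: scaleR_matrix_vector_assoc)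
  have "(\<Sum>j\<in>K. \<beta> j * (x \<bullet> (G j *v x))) \<le> (\<Sum>j\<in>K. \<beta> j * (x \<bullet> x))"
    by (rule sum_mono) (simp add: G assms(2) mult_left_mono)
  also have "\<dots> = x \<bullet> x"
    by (simp add: assms(3) flip: sum_distrib_right)
  finally show "0 \<le> x \<bullet> (?A *v x) \<and> x \<bullet> (?A *v x) \<le> x \<bullet> x"
    unfolding form using G assms(2) by (simp add: sum_nonneg)
qed

lemma patch_mat_apply: "(patch_mat idx i *v x) $ k = x $ idx i k"
proof -
  have "(patch_mat idx i *v x) $ k = (\<Sum>j\<in>UNIV. (if idx i k = j then 1 else 0) * x $ j)"
    by (simp add: patch_mat_def matrix_vector_mult_def)
  also have "\<dots> = (\<Sum>j\<in>UNIV. if idx i k = j then x $ j else 0)"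
    by (rule sum.cong) auto
  finally show ?thesis by simp
qed

lemma sum_inner_patch_mat:
  fixes idx :: "'i::finite \<Rightarrow> 'p::finite \<Rightarrow> 'n::finite"
  assumes cover: "\<And>a. card {(i, k). idx i k = a} = CARD('p)"
  shows "(\<Sum>i\<in>UNIV. (patch_mat idx i *v x) \<bullet> (patch_mat idx i *v x)) = real CARD('p) * (x \<bullet> x)"
proof -
  have "(\<Sum>i\<in>UNIV. (patch_mat idx i *v x) \<bullet> (patch_mat idx i *v x))
      = (\<Sum>ik\<in>UNIV. (x $ case_prod idx ik)\<^sup>2)"
    by (simp add: inner_vec_def patch_mat_apply power2_eq_square sum.cartesian_product
        split_def flip: UNIV_Times_UNIV)
  also have "\<dots> = (\<Sum>a\<in>UNIV. \<Sum>ik\<in>{ik\<in>UNIV. case_prod idx ik = a}. (x $ case_prod idx ik)\<^sup>2)"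
    by (rule sum.group[symmetric]) auto
  also have "\<dots> = (\<Sum>a\<in>UNIV. real CARD('p) * (x $ a)\<^sup>2)"
  proof (rule sum.cong[OF refl])
    fix a
    have "(\<Sum>ik\<in>{ik\<in>UNIV. case_prod idx ik = a}. (x $ case_prod idx ik)\<^sup>2)
        = (\<Sum>ik\<in>{(i, k). idx i k = a}. (x $ a)\<^sup>2)"
      by (rule sum.cong) auto
    then show "(\<Sum>ik\<in>{ik\<in>UNIV. case_prod idx ik = a}. (x $ case_prod idx ik)\<^sup>2)
        = real CARD('p) * (x $ a)\<^sup>2"
      using cover[of a] by simp
  qed
  also have "\<dots> = real CARD('p) * (x \<bullet> x)"
    by (simp add: inner_vec_def sum_distrib_left power2_eq_square)
  finally show ?thesis .
qed

lemma inner_vector_matrix: "x \<bullet> (z v* P) = (P *v x) \<bullet> (z :: real^'m)"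
  by (metis dot_lmul_matrix inner_commute)

lemma form_between_0_and_id_patch_average:
  fixes idx :: "'i::finite \<Rightarrow> 'p::finite \<Rightarrow> 'n::finite"
  assumes cover: "\<And>a. card {(i, k). idx i k = a} = CARD('p)"
    and F: "\<And>i. form_between_0_and_id (F i)"
  shows "form_between_0_and_id ((1 / real CARD('p)) *\<^sub>R
           (\<Sum>i\<in>UNIV. transpose (patch_mat idx i) ** F i ** patch_mat idx i))"
    (is "form_between_0_and_id ?W")
  unfolding form_between_0_and_id_def
proof
  fix x
  let ?P = "patch_mat idx"
  let ?s = "\<Sum>i\<in>UNIV. (?P i *v x) \<bullet> (F i *v (?P i *v x))"
  have form: "x \<bullet> (?W *v x) = ?s / real CARD('p)"
    by (simp add: matrix_vector_mult_sum_left inner_sum_right inner_vector_matrix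
        sum_divide_distrib flip: scaleR_matrix_vector_assoc matrix_vector_mul_assoc)
  have "0 \<le> ?s"
    using F by (simp add: form_between_0_and_id_def sum_nonneg)
  moreover have "?s \<le> (\<Sum>i\<in>UNIV. (?P i *v x) \<bullet> (?P i *v x))"
    using F by (simp add: form_between_0_and_id_def sum_mono)
  ultimately show "0 \<le> x \<bullet> (?W *v x) \<and> x \<bullet> (?W *v x) \<le> x \<bullet> x"
    unfolding form sum_inner_patch_mat[OF cover] by (simp add: field_simps)
qed

section \<open>Indicator of a set plus a finite convex function\<close>

lemma epigraph_ext_indicator_plus:
  "epigraph_ext (\<lambda>x. indicator_fun S x + ereal (f x)) = epigraph S f"
  by (auto simp: epigraph_ext_def epigraph_def indicator_fun_def split: if_splits)

lemma closed_fun_indicator_plus: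
  fixes f :: "'a::topological_space \<Rightarrow> real"
  assumes "closed S" "continuous_on S f"
  shows "closed_fun (\<lambda>x. indicator_fun S x + ereal (f x))"
proof -
  have "epigraph S f = {p \<in> S \<times> UNIV. f (fst p) \<le> snd p}"
    by (auto simp: epigraph_def)
  moreover have "closed {p \<in> S \<times> UNIV. f (fst p) \<le> snd p}"
    by (intro continuous_on_closed_Collect_le closed_Times assms(1) closed_UNIV
        continuous_on_snd continuous_on_compose2[OF assms(2) continuous_on_fst]) auto
  ultimately show ?thesis
    by (simp add: closed_fun_def epigraph_ext_indicator_plus)
qed

lemma proper_fun_indicator_plus:
  assumes "S \<noteq> {}"
  shows "proper_fun (\<lambda>x. indicator_fun S x + ereal (f x))"
  using assms by (auto simp: proper_fun_def indicator_fun_def)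

lemma convex_fun_indicator_plus:
  assumes "convex_on S f"
  shows "convex_fun (\<lambda>x. indicator_fun S x + ereal (f x))"
  using assms by (simp add: convex_fun_def epigraph_ext_indicator_plus convex_epigraph)

lemma prox_set_indicator_plus_eq_singleton:
  fixes f :: "'a::real_normed_vector \<Rightarrow> real"
  assumes "p \<in> S"
    and strict: "\<And>x. x \<in> S \<Longrightarrow> x \<noteq> p \<Longrightarrow>
      (norm (p - y))\<^sup>2 / 2 + f p < (norm (x - y))\<^sup>2 / 2 + f x"
  shows "prox_set (\<lambda>x. indicator_fun S x + ereal (f x)) y = {p}"
proof -
  have objective: "ereal ((norm (x - y))\<^sup>2 / 2) + (indicator_fun S x + ereal (f x))
      = (if x \<in> S then ereal ((norm (x - y))\<^sup>2 / 2 + f x) else \<infinity>)" for x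
    by (simp add: indicator_fun_def)
  have le: "ereal ((norm (p - y))\<^sup>2 / 2 + f p)
      \<le> (if x \<in> S then ereal ((norm (x - y))\<^sup>2 / 2 + f x) else \<infinity>)" for x
    using strict[of x] by (cases "x = p") auto
  then have "p \<in> prox_set (\<lambda>x. indicator_fun S x + ereal (f x)) y"
    unfolding prox_set_def objective using assms(1) by simp
  moreover have "z = p" if "z \<in> prox_set (\<lambda>x. indicator_fun S x + ereal (f x)) y" for z
  proof -
    have "\<forall>x. (if z \<in> S then ereal ((norm (z - y))\<^sup>2 / 2 + f z) else \<infinity>)
        \<le> (if x \<in> S then ereal ((norm (x - y))\<^sup>2 / 2 + f x) else \<infinity>)"
      using that unfolding prox_set_def objective by simp
    then have "(if z \<in> S then ereal ((norm (z - y))\<^sup>2 / 2 + f z) else \<infinity>)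
        \<le> ereal ((norm (p - y))\<^sup>2 / 2 + f p)"
      using assms(1) by (metis (full_types))
    then show "z = p"
      using strict[of z] by (auto split: if_splits)
  qed
  ultimately show ?thesis by blast
qed

lemma convex_on_sq_inner: "convex_on UNIV (\<lambda>x. (a \<bullet> x)\<^sup>2)"
proof (rule convex_onI)
  fix t :: real and x y :: 'a
  assume t: "0 < t" "t < 1"
  have "(a \<bullet> ((1 - t) *\<^sub>R x + t *\<^sub>R y))\<^sup>2 = ((1 - t) *\<^sub>R (a \<bullet> x) + t *\<^sub>R (a \<bullet> y))\<^sup>2"
    by (simp add: inner_add_right)
  also have "\<dots> \<le> (1 - t) * (a \<bullet> x)\<^sup>2 + t * (a \<bullet> y)\<^sup>2"
    using convex_onD[OF convex_power2] t by simp
  finally show "(a \<bullet> ((1 - t) *\<^sub>R x + t *\<^sub>R y))\<^sup>2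
      \<le> (1 - t) * (a \<bullet> x)\<^sup>2 + t * (a \<bullet> y)\<^sup>2" .
qed simp

lemma convex_on_weighted_sum_sq_inner:
  assumes "\<And>k. k \<in> K \<Longrightarrow> 0 \<le> c k"
  shows "convex_on UNIV (\<lambda>x. \<Sum>k\<in>K. c k * (q k \<bullet> x)\<^sup>2)"
  using assms
proof (induction K rule: infinite_finite_induct)
  case (insert k K)
  then show ?case
    by (simp add: convex_on_add convex_on_cmul convex_on_sq_inner)
qed (simp_all add: convex_on_const)

section \<open>Spectral decomposition with respect to an orthonormal basis\<close>

lemma span_columns_eq_range: "span (columns A) = range ((*v) (A :: real^'n^'m))"
proof
  show "span (columns A) \<subseteq> range ((*v) A)"
    by (rule span_minimal) (auto simp: columns_image_basis
        intro: linear_subspace_image[OF matrix_vector_mul_linear subspace_UNIV])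
  show "range ((*v) A) \<subseteq> span (columns A)"
    using matrix_vector_mult_in_columnspace by auto
qed

lemma down_closed_eq_lessThan_card:
  assumes "finite T" "\<And>l k. l \<in> T \<Longrightarrow> k < l \<Longrightarrow> k \<in> (T :: nat set)"
  shows "T = {..<card T}"
proof (cases "T = {}")
  case False
  have "T = {..Max T}"
  proof
    show "T \<subseteq> {..Max T}" using assms(1) by auto
    show "{..Max T} \<subseteq> T"
    proof
      fix k assume "k \<in> {..Max T}"
      moreover have "Max T \<in> T" using False assms(1) by simp
      ultimately show "k \<in> T" using assms(2) by (cases "k = Max T") auto
    qed
  qed
  then show ?thesis by (metis card_atMost lessThan_Suc_atMost)
qed simp

lemma nonzero_antimono_eq_lessThan_card:
  fixes lam :: "nat \<Rightarrow> real"
  assumes nonneg: "\<And>k. k < N \<Longrightarrow> 0 \<le> lam k"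
    and antimono: "\<And>k l. k \<le> l \<Longrightarrow> l < N \<Longrightarrow> lam l \<le> lam k"
  shows "{k. k < N \<and> lam k \<noteq> 0} = {..<card {k. k < N \<and> lam k \<noteq> 0}}"
proof (rule down_closed_eq_lessThan_card)
  fix l k assume l: "l \<in> {k. k < N \<and> lam k \<noteq> 0}" and "k < l"
  then have "0 < lam l" "lam l \<le> lam k" "k < N"
    using nonneg[of l] antimono[of k l] by auto
  then show "k \<in> {k. k < N \<and> lam k \<noteq> 0}" by simp
qed simp

locale orthonormal_eigendecomposition =
  fixes q :: "nat \<Rightarrow> real^'n" and lam :: "nat \<Rightarrow> real" and W :: "real^'n^'n"
  assumes orthonormal: "\<And>k l. k < CARD('n) \<Longrightarrow> l < CARD('n) \<Longrightarrow>
      q k \<bullet> q l = (if k = l then 1 else 0)"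
    and eigendecomposition: "W = (\<chi> a b. \<Sum>k<CARD('n). q k $ a * lam k * q k $ b)"
begin

lemma inj_on_q: "inj_on q {..<CARD('n)}"
  by (rule inj_onI) (metis lessThan_iff orthonormal zero_neq_one)

lemma independent_image_q: "independent (q ` {..<CARD('n)})"
proof (rule pairwise_orthogonal_independent)
  show "pairwise orthogonal (q ` {..<CARD('n)})"
    unfolding pairwise_def orthogonal_def using orthonormal by auto
  show "0 \<notin> q ` {..<CARD('n)}"
    using orthonormal by (auto simp del: inner_zero_left) (metis inner_zero_left zero_neq_one)
qed

lemma span_image_q: "span (q ` {..<CARD('n)}) = UNIV"
proof -
  have "UNIV \<subseteq> span (q ` {..<CARD('n)})"
    by (rule card_ge_dim_independent[OF subset_UNIV independent_image_q])
      (simp add: card_image[OF inj_on_q])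
  then show ?thesis by auto
qed

lemma expansion: "v = (\<Sum>k<CARD('n). (q k \<bullet> v) *\<^sub>R q k)"
proof -
  define u where "u = v - (\<Sum>k<CARD('n). (q k \<bullet> v) *\<^sub>R q k)"
  have uq: "u \<bullet> q l = 0" if "l < CARD('n)" for l
  proof -
    have "(\<Sum>k<CARD('n). (q k \<bullet> v) *\<^sub>R q k) \<bullet> q l
        = (\<Sum>k<CARD('n). (q k \<bullet> v) * (q k \<bullet> q l))"
      by (simp add: inner_sum_left)
    also have "\<dots> = (\<Sum>k<CARD('n). if k = l then q l \<bullet> v else 0)"
      by (rule sum.cong) (use orthonormal that in auto)
    also have "\<dots> = q l \<bullet> v" using that by simp
    finally show ?thesis
      unfolding u_def inner_diff_left by (simp add: inner_commute)
  qed
  have "orthogonal u u"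
  proof (rule orthogonal_to_span)
    show "u \<in> span (q ` {..<CARD('n)})" by (simp add: span_image_q)
  qed (auto simp: orthogonal_def uq)
  then show ?thesis by (simp add: u_def orthogonal_def)
qed

lemma eq_0_if_coordinates_0:
  assumes "\<And>k. k < CARD('n) \<Longrightarrow> q k \<bullet> v = 0"
  shows "v = 0"
proof -
  have "v = (\<Sum>k<CARD('n). (q k \<bullet> v) *\<^sub>R q k)" by (rule expansion)
  also have "\<dots> = 0" using assms by simp
  finally show ?thesis .
qed

lemma norm_sq_eq: "(norm v)\<^sup>2 = (\<Sum>k<CARD('n). (q k \<bullet> v)\<^sup>2)"
proof -
  have "(norm v)\<^sup>2 = v \<bullet> (\<Sum>k<CARD('n). (q k \<bullet> v) *\<^sub>R q k)"
    by (metis expansion power2_norm_eq_inner)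
  then show ?thesis
    by (simp add: inner_sum_right inner_commute power2_eq_square)
qed

lemma W_apply: "W *v v = (\<Sum>k<CARD('n). (lam k * (q k \<bullet> v)) *\<^sub>R q k)"
proof -
  have "(W *v v) $ a = (\<Sum>k<CARD('n). lam k * (q k \<bullet> v) * q k $ a)" for a
  proof -
    have "(W *v v) $ a = (\<Sum>b\<in>UNIV. \<Sum>k<CARD('n). q k $ a * lam k * q k $ b * v $ b)"
      by (simp add: eigendecomposition matrix_vector_mult_def sum_distrib_right)
    also have "\<dots> = (\<Sum>k<CARD('n). \<Sum>b\<in>UNIV. q k $ a * lam k * q k $ b * v $ b)"
      by (rule sum.swap)
    finally show ?thesis
      by (simp add: inner_vec_def sum_distrib_left sum_distrib_right mult_ac)
  qed
  then show ?thesis by (simp add: vec_eq_iff sum_component)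
qed

lemma inner_W: "k < CARD('n) \<Longrightarrow> q k \<bullet> (W *v v) = lam k * (q k \<bullet> v)"
  unfolding W_apply inner_sum_right
  by (simp add: orthonormal if_distrib[of "\<lambda>t. _ * t"] sum.delta cong: if_cong)

lemma W_eigenvector:
  assumes "k < CARD('n)"
  shows "W *v q k = lam k *\<^sub>R q k"
proof -
  have "W *v q k = (\<Sum>j<CARD('n). if j = k then lam k *\<^sub>R q k else 0)"
    unfolding W_apply by (rule sum.cong) (use orthonormal assms in auto)
  then show ?thesis using assms by simp
qed

lemma eigenvalue_bounds:
  assumes "form_between_0_and_id W" "k < CARD('n)"
  shows "0 \<le> lam k \<and> lam k \<le> 1"
proof -
  have "q k \<bullet> q k = 1" using orthonormal[OF assms(2) assms(2)] by simp
  moreover have "lam k = q k \<bullet> (W *v q k)"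
    using calculation by (simp add: W_eigenvector[OF assms(2)])
  ultimately show ?thesis
    using assms(1) unfolding form_between_0_and_id_def by metis
qed

lemma range_W_eq_span: "range ((*v) W) = span (q ` {k. k < CARD('n) \<and> lam k \<noteq> 0})"
proof
  show "range ((*v) W) \<subseteq> span (q ` {k. k < CARD('n) \<and> lam k \<noteq> 0})"
  proof clarify
    fix v
    have "W *v v = (\<Sum>k\<in>{k. k < CARD('n) \<and> lam k \<noteq> 0}. (lam k * (q k \<bullet> v)) *\<^sub>R q k)"
      unfolding W_apply by (rule sum.mono_neutral_right) auto
    also have "\<dots> \<in> span (q ` {k. k < CARD('n) \<and> lam k \<noteq> 0})"
      by (intro span_sum span_scale span_base imageI)
    finally show "W *v v \<in> span (q ` {k. k < CARD('n) \<and> lam k \<noteq> 0})" .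
  qed
  have "q k \<in> range ((*v) W)" if "k < CARD('n)" "lam k \<noteq> 0" for k
  proof -
    have "W *v ((1 / lam k) *\<^sub>R q k) = q k"
      using that by (simp add: matrix_vector_mult_scaleR W_eigenvector)
    then show ?thesis by (metis rangeI)
  qed
  then show "span (q ` {k. k < CARD('n) \<and> lam k \<noteq> 0}) \<subseteq> range ((*v) W)"
    by (intro span_minimal linear_subspace_image[OF matrix_vector_mul_linear subspace_UNIV]) auto
qed

lemma rank_eq_card_nonzero: "rank W = card {k. k < CARD('n) \<and> lam k \<noteq> 0}"
proof -
  have sub: "{k. k < CARD('n) \<and> lam k \<noteq> 0} \<subseteq> {..<CARD('n)}" by auto
  have "rank W = dim (span (q ` {k. k < CARD('n) \<and> lam k \<noteq> 0}))"
    by (simp add: rank_dim_range range_W_eq_span)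
  also have "\<dots> = card (q ` {k. k < CARD('n) \<and> lam k \<noteq> 0})"
    by (simp add: dim_span dim_eq_card_independent
        independent_mono[OF independent_image_q image_mono[OF sub]])
  also have "\<dots> = card {k. k < CARD('n) \<and> lam k \<noteq> 0}"
    by (rule card_image[OF inj_on_subset[OF inj_on_q sub]])
  finally show ?thesis .
qed

lemma inner_range_W_eq_0:
  assumes "v \<in> range ((*v) W)" "k < CARD('n)" "lam k = 0"
  shows "q k \<bullet> v = 0"
  using assms inner_W by auto

context
  fixes r :: nat
  assumes nonneg: "\<And>k. k < CARD('n) \<Longrightarrow> 0 \<le> lam k"
    and nonzero: "{k. k < CARD('n) \<and> lam k \<noteq> 0} = {..<r}"
begin

lemma r_le_card: "r \<le> CARD('n)"
  using nonzero by (metis (no_types, lifting) lessThan_iff mem_Collect_eq not_le order_less_irrefl)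

lemma eigenvalue_pos:
  assumes "k < r"
  shows "0 < lam k"
proof -
  have "k \<in> {k. k < CARD('n) \<and> lam k \<noteq> 0}" unfolding nonzero using assms by simp
  then show ?thesis using nonneg[of k] by simp
qed

lemma eigenvalue_zero:
  assumes "r \<le> k" "k < CARD('n)"
  shows "lam k = 0"
proof -
  have "k \<notin> {k. k < CARD('n) \<and> lam k \<noteq> 0}" unfolding nonzero using assms(1) by simp
  then show ?thesis using assms(2) by simp
qed

lemma completed_square:
  assumes x: "x \<in> range ((*v) W)"
  shows "(norm (x - y))\<^sup>2 + (\<Sum>k<r. (1 / lam k - 1) * (q k \<bullet> x)\<^sup>2)
    = (\<Sum>k<r. (q k \<bullet> (x - W *v y))\<^sup>2 / lam k) + (\<Sum>k<r. (1 - lam k) * (q k \<bullet> y)\<^sup>2)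
      + (\<Sum>k\<in>{r..<CARD('n)}. (q k \<bullet> y)\<^sup>2)"
proof -
  have split: "(\<Sum>k<CARD('n). g k) = (\<Sum>k<r. g k) + (\<Sum>k\<in>{r..<CARD('n)}. g k)" for g :: "nat \<Rightarrow> real"
    using sum.atLeastLessThan_concat[of 0 r "CARD('n)" g] r_le_card by (simp add: lessThan_atLeast0)
  have "(\<Sum>k\<in>{r..<CARD('n)}. (q k \<bullet> x - q k \<bullet> y)\<^sup>2) = (\<Sum>k\<in>{r..<CARD('n)}. (q k \<bullet> y)\<^sup>2)"
    by (rule sum.cong) (auto simp: inner_range_W_eq_0[OF x] eigenvalue_zero)
  moreover have "(q k \<bullet> x - q k \<bullet> y)\<^sup>2 + (1 / lam k - 1) * (q k \<bullet> x)\<^sup>2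
      = (q k \<bullet> (x - W *v y))\<^sup>2 / lam k + (1 - lam k) * (q k \<bullet> y)\<^sup>2" if "k < r" for k
  proof -
    have "lam k \<noteq> 0" using eigenvalue_pos[OF that] by simp
    then show ?thesis
      using that r_le_card by (simp add: inner_diff_right inner_W field_simps power2_eq_square)
  qed
  ultimately show ?thesis
    by (simp add: norm_sq_eq[of "x - y"] inner_diff_right split sum.distrib[symmetric])
qed

lemma prox_set_range_W:
  "prox_set (\<lambda>x. indicator_fun (range ((*v) W)) x
      + ereal ((1/2) * (\<Sum>k<r. (1 / lam k - 1) * (q k \<bullet> x)\<^sup>2))) y = {W *v y}"
proof (rule prox_set_indicator_plus_eq_singleton)
  fix x assume x: "x \<in> range ((*v) W)" "x \<noteq> W *v y"
  obtain k where k: "k < CARD('n)" "q k \<bullet> (x - W *v y) \<noteq> 0"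
    using eq_0_if_coordinates_0[of "x - W *v y"] x(2) by auto
  have "k < r"
  proof (rule ccontr)
    assume "\<not> k < r"
    then have "lam k = 0" using eigenvalue_zero k(1) by simp
    then have "q k \<bullet> x = 0" "q k \<bullet> (W *v y) = 0"
      using inner_range_W_eq_0 x(1) k(1) by auto
    then show False using k(2) by (simp add: inner_diff_right)
  qed
  then have "0 < (\<Sum>k<r. (q k \<bullet> (x - W *v y))\<^sup>2 / lam k)"
    using k eigenvalue_pos by (intro sum_pos2[of _ k]) (auto intro: divide_nonneg_pos)
  then show "(norm (W *v y - y))\<^sup>2 / 2 + (1/2) * (\<Sum>k<r. (1 / lam k - 1) * (q k \<bullet> (W *v y))\<^sup>2)
      < (norm (x - y))\<^sup>2 / 2 + (1/2) * (\<Sum>k<r. (1 / lam k - 1) * (q k \<bullet> x)\<^sup>2)"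
    using completed_square[OF x(1), of y] completed_square[of "W *v y" y] by simp
qed simp

end

end

theorem corollary1:
  fixes idx :: "'i::finite \<Rightarrow> 'p::finite \<Rightarrow> 'n::finite"
    and C :: "'k::finite \<Rightarrow> real^'p^'p"
    and \<sigma> :: real
    and \<beta> :: "'i \<Rightarrow> 'k \<Rightarrow> real"
    and F :: "'i \<Rightarrow> real^'p^'p"
    and W :: "real^'n^'n"
    and q :: "nat \<Rightarrow> real^'n"
    and lam :: "nat \<Rightarrow> real"
    and r :: nat
    and \<phi> :: "real^'n \<Rightarrow> ereal"
  assumes patch_inj: "\<And>i. inj (idx i)"
    and patch_cover: "\<And>x. card {(i, k). idx i k = x} = CARD('p)"
    and C_sym: "\<And>j. transpose (C j) = C j"
    and C_psd: "\<And>j v. 0 \<le> v \<bullet> (C j *v v)"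
    and sigma_pos: "\<sigma>\<^sup>2 > 0"
    and beta_nonneg: "\<And>i j. \<beta> i j \<ge> 0"
    and beta_sum: "\<And>i. (\<Sum>j\<in>UNIV. \<beta> i j) = 1"
    and F_def: "\<And>i. F i = (\<Sum>j\<in>UNIV. \<beta> i j *\<^sub>R (C j ** matrix_inv (C j + mat (\<sigma>\<^sup>2))))"
    and W_def: "W = (1 / real CARD('p)) *\<^sub>R
                    (\<Sum>i\<in>UNIV. transpose (patch_mat idx i) ** F i ** patch_mat idx i)"
    and Q_orth: "\<And>k l. k < CARD('n) \<Longrightarrow> l < CARD('n) \<Longrightarrow>
                   q k \<bullet> q l = (if k = l then 1 else 0)"
    and W_eig: "W = (\<chi> a b. \<Sum>k<CARD('n). q k $ a * lam k * q k $ b)"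
    and lam_decr: "\<And>k l. k \<le> l \<Longrightarrow> l < CARD('n) \<Longrightarrow> lam l \<le> lam k"
    and r_def: "r = rank W"
    and phi_def: "\<And>x. \<phi> x = indicator_fun (span (columns W)) x +
                   ereal ((1/2) * (\<Sum>k<r. (1 / lam k - 1) * (q k \<bullet> x)\<^sup>2))"
  shows "closed_fun \<phi> \<and> proper_fun \<phi> \<and> convex_fun \<phi> \<and>
         (\<forall>y. prox_set \<phi> y = {W *v y})"
proof -
  interpret orthonormal_eigendecomposition q lam W
    using Q_orth W_eig by unfold_locales
  have "form_between_0_and_id W"
    unfolding W_def F_def
    by (intro form_between_0_and_id_patch_average[OF patch_cover]
        form_between_0_and_id_convex_combination form_between_0_and_id_resolvent
        C_psd sigma_pos beta_nonneg beta_sum) auto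
  then have lam01: "0 \<le> lam k \<and> lam k \<le> 1" if "k < CARD('n)" for k
    using that by (rule eigenvalue_bounds)
  have nonzero: "{k. k < CARD('n) \<and> lam k \<noteq> 0} = {..<r}"
    using nonzero_antimono_eq_lessThan_card[of "CARD('n)" lam] lam01 lam_decr
    by (simp add: r_def rank_eq_card_nonzero)
  define f where "f x = (1/2) * (\<Sum>k<r. (1 / lam k - 1) * (q k \<bullet> x)\<^sup>2)" for x
  have \<phi>: "\<phi> = (\<lambda>x. indicator_fun (range ((*v) W)) x + ereal (f x))"
    by (simp add: fun_eq_iff phi_def f_def span_columns_eq_range)
  have nonneg: "\<And>k. k < CARD('n) \<Longrightarrow> 0 \<le> lam k" using lam01 by blast
  have "0 \<le> 1 / lam k - 1" if "k < r" for k
    using eigenvalue_pos[OF nonneg nonzero that] lam01 r_le_card[OF nonneg nonzero] that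
    by (simp add: field_simps)
  then have "convex_on UNIV f"
    unfolding f_def by (intro convex_on_cmul convex_on_weighted_sum_sq_inner) auto
  moreover have "continuous_on UNIV f"
    unfolding f_def by (intro continuous_intros)
  moreover have "subspace (range ((*v) W))"
    by (rule linear_subspace_image[OF matrix_vector_mul_linear subspace_UNIV])
  moreover have "prox_set (\<lambda>x. indicator_fun (range ((*v) W)) x + ereal (f x)) y = {W *v y}" for y
    unfolding f_def by (rule prox_set_range_W[OF nonneg nonzero])
  ultimately show ?thesis
    unfolding \<phi>
    by (auto intro!: closed_fun_indicator_plus proper_fun_indicator_plus convex_fun_indicator_plus
        closed_subspace subspace_imp_convex intro: convex_on_subset continuous_on_subset)
qed

end
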